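(* Let $n\geq 2$ be an integer. If $A$ is a non-empty subset of $U(n)$, then $C_{A,\mathbb Z_n'}(n)=2\,C_A(n)$. If $A\subseteq\mathbb Z_n'$ is non-empty and $A\not\subseteq U(n)$, then $C_{A,\mathbb Z_n'}(n)=C_A(n)$.
   Context: $\mathbb Z_n=\mathbb Z/n\mathbb Z$ as a module over itself, $\mathbb Z_n'=\mathbb Z_n\setminus\{0\}$, and $U(n)$ is the group of units of $\mathbb Z_n$. A sequence $(x_1,\ldots,x_k)$ is an $A$-weighted zero-sum sequence if there exist $a_i\in A$ with $\sum a_ix_i=0$, and an $(A,B)$-weighted zero-sum sequence if there exist $a_i\in A$, $b_i\in B$ with $\sum a_ix_i=0$ and $\sum b_ia_i=0$. $C_{A,B}(n)$ (resp. $C_A(n)$) is the least positive $k$ such that every sequence of length $k$ in $\mathbb Z_n$ has an $(A,B)$-weighted (resp. $A$-weighted) zero-sum subsequence having consecutive terms, i.e. a non-empty block $(x_i,\ldots,x_j)$. *)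

theory Defs
  imports "HOL-Number_Theory.Residues" "HOL-Library.Sublist"
begin

text \<open>Weights and sequences live in the ring \<open>R\<close>, regarded as a module over itself.\<close>

definition weighted_zero_sum :: "('a, 'm) ring_scheme \<Rightarrow> 'a set \<Rightarrow> 'a list \<Rightarrow> bool" where
  "weighted_zero_sum R A xs \<longleftrightarrow>
     (\<exists>a. (\<forall>i<length xs. a i \<in> A) \<and>
        (\<Oplus>\<^bsub>R\<^esub>i\<in>{..<length xs}. a i \<otimes>\<^bsub>R\<^esub> xs ! i) = \<zero>\<^bsub>R\<^esub>)"

definition weighted_zero_sum2 ::
  "('a, 'm) ring_scheme \<Rightarrow> 'a set \<Rightarrow> 'a set \<Rightarrow> 'a list \<Rightarrow> bool" where
  "weighted_zero_sum2 R A B xs \<longleftrightarrow>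
     (\<exists>a b. (\<forall>i<length xs. a i \<in> A) \<and> (\<forall>i<length xs. b i \<in> B) \<and>
        (\<Oplus>\<^bsub>R\<^esub>i\<in>{..<length xs}. a i \<otimes>\<^bsub>R\<^esub> xs ! i) = \<zero>\<^bsub>R\<^esub> \<and>
        (\<Oplus>\<^bsub>R\<^esub>i\<in>{..<length xs}. b i \<otimes>\<^bsub>R\<^esub> a i) = \<zero>\<^bsub>R\<^esub>)"

text \<open>The library's \<^const>\<open>sublist\<close> relation is the contiguous one.\<close>

definition C_one :: "int set \<Rightarrow> int \<Rightarrow> nat" where
  "C_one A n = (LEAST k. k > 0 \<and>
     (\<forall>xs. set xs \<subseteq> carrier (residue_ring n) \<and> length xs = k \<longrightarrow>
        (\<exists>ys. ys \<noteq> [] \<and> sublist ys xs \<and> weighted_zero_sum (residue_ring n) A ys)))"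

definition C_two :: "int set \<Rightarrow> int set \<Rightarrow> int \<Rightarrow> nat" where
  "C_two A B n = (LEAST k. k > 0 \<and>
     (\<forall>xs. set xs \<subseteq> carrier (residue_ring n) \<and> length xs = k \<longrightarrow>
        (\<exists>ys. ys \<noteq> [] \<and> sublist ys xs \<and> weighted_zero_sum2 (residue_ring n) A B ys)))"

definition U :: "int \<Rightarrow> int set" where
  "U n = Units (residue_ring n)"

definition Z_nonzero :: "int \<Rightarrow> int set" where
  "Z_nonzero n = carrier (residue_ring n) - {\<zero>\<^bsub>residue_ring n\<^esub>}"

end

theory Submission
  imports Defs
begin

text \<open>
  If \<open>A\<close> consists of units, a zero term alone is no \<open>(A, B)\<close>-weighted zero-sum block, so inserting
  zeros around and between the terms of a sequence of length \<open>C\<^sub>A(n) - 1\<close> without \<open>A\<close>-weighted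
  zero-sum block gives a sequence of length \<open>2 C\<^sub>A(n) - 1\<close> without \<open>(A, B)\<close>-weighted one.
  Conversely, adding consecutive terms in pairs turns a sequence of length \<open>2 C\<^sub>A(n)\<close> into one of
  length \<open>C\<^sub>A(n)\<close>; a zero-sum block of the latter lifts to one in which both members of a pair
  carry the same weight, and the coefficients \<open>1, -1\<close> cancel on each pair.

  If \<open>A\<close> contains a non-unit, then \<open>n \<ge> 3\<close>, and any at least two nonzero weights have a vanishing
  combination with nonzero coefficients: annihilate them all if none is a unit, otherwise solve for
  the coefficient of a unit after making the sum of the other terms nonzero. In a zero-sum block
  consisting of a single zero the weight can be replaced by the non-unit.
\<close>

text \<open>Blocks are given by endpoints, and weights are indexed by position in the whole
  sequence, so blocks can be shortened, doubled or interleaved by index arithmetic on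
  integers.\<close>

definition one_block :: "int \<Rightarrow> int set \<Rightarrow> int list \<Rightarrow> bool" where
  "one_block n A xs \<longleftrightarrow> (\<exists>i j a. i < j \<and> j \<le> length xs \<and> (\<forall>t\<in>{i..<j}. a t \<in> A) \<and>
     n dvd (\<Sum>t=i..<j. a t * xs ! t))"

definition two_block :: "int \<Rightarrow> int set \<Rightarrow> int set \<Rightarrow> int list \<Rightarrow> bool" where
  "two_block n A B xs \<longleftrightarrow> (\<exists>i j a b. i < j \<and> j \<le> length xs \<and>
     (\<forall>t\<in>{i..<j}. a t \<in> A) \<and> (\<forall>t\<in>{i..<j}. b t \<in> B) \<and>
     n dvd (\<Sum>t=i..<j. a t * xs ! t) \<and> n dvd (\<Sum>t=i..<j. b t * a t))"

subsection \<open>Translation to integer congruences\<close>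

lemma finsum_residue_ring_mult:
  assumes "n \<ge> 2" and "finite I"
  shows "(\<Oplus>\<^bsub>residue_ring n\<^esub>i\<in>I. f i \<otimes>\<^bsub>residue_ring n\<^esub> g i) = (\<Sum>i\<in>I. f i * g i) mod n"
proof -
  interpret residues n "residue_ring n"
    by unfold_locales (use assms in auto)
  \<comment> \<open>Multiplication reduces modulo \<open>n\<close>, so even factors outside the
    carrier have their product in it.\<close>
  have mem: "f i \<otimes>\<^bsub>residue_ring n\<^esub> g i \<in> carrier (residue_ring n)" for i
    using assms by (simp add: res_mult_eq res_carrier_eq)
  show ?thesis
    using assms(2)
  proof induction
    case (insert x I)
    have "(\<Oplus>\<^bsub>residue_ring n\<^esub>i\<in>insert x I. f i \<otimes>\<^bsub>residue_ring n\<^esub> g i)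
        = (f x \<otimes>\<^bsub>residue_ring n\<^esub> g x) \<oplus>\<^bsub>residue_ring n\<^esub> ((\<Sum>i\<in>I. f i * g i) mod n)"
      using insert mem by (subst finsum_insert) auto
    also have "\<dots> = (\<Sum>i\<in>insert x I. f i * g i) mod n"
      using insert by (simp add: res_add_eq res_mult_eq mod_simps)
    finally show ?case .
  qed (simp add: res_zero_eq)
qed

lemma zero_residue_ring: "\<zero>\<^bsub>residue_ring n\<^esub> = 0"
  by (simp add: residue_ring_def)

lemma weighted_zero_sum_iff:
  assumes "n \<ge> 2"
  shows "weighted_zero_sum (residue_ring n) A xs \<longleftrightarrow>
    (\<exists>a. (\<forall>i<length xs. a i \<in> A) \<and> n dvd (\<Sum>i<length xs. a i * xs ! i))"
  using assms
  by (simp add: weighted_zero_sum_def finsum_residue_ring_mult zero_residue_ring dvd_eq_mod_eq_0)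

lemma weighted_zero_sum2_iff:
  assumes "n \<ge> 2"
  shows "weighted_zero_sum2 (residue_ring n) A B xs \<longleftrightarrow>
    (\<exists>a b. (\<forall>i<length xs. a i \<in> A) \<and> (\<forall>i<length xs. b i \<in> B) \<and>
      n dvd (\<Sum>i<length xs. a i * xs ! i) \<and> n dvd (\<Sum>i<length xs. b i * a i))"
  using assms
  by (simp add: weighted_zero_sum2_def finsum_residue_ring_mult zero_residue_ring dvd_eq_mod_eq_0)

lemma ex_sublist_iff:
  "(\<exists>ys. ys \<noteq> [] \<and> sublist ys xs \<and> P ys) \<longleftrightarrow>
    (\<exists>i j. i < j \<and> j \<le> length xs \<and> P (take (j - i) (drop i xs)))"
proof
  assume "\<exists>ys. ys \<noteq> [] \<and> sublist ys xs \<and> P ys"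
  then obtain ys ps ss where "ys \<noteq> []" "P ys" "xs = ps @ ys @ ss"
    by (auto simp: sublist_def)
  then show "\<exists>i j. i < j \<and> j \<le> length xs \<and> P (take (j - i) (drop i xs))"
    by (intro exI[of _ "length ps"] exI[of _ "length ps + length ys"]) simp
next
  assume "\<exists>i j. i < j \<and> j \<le> length xs \<and> P (take (j - i) (drop i xs))"
  then obtain i j where ij: "i < j" "j \<le> length xs" "P (take (j - i) (drop i xs))"
    by blast
  have "sublist (take (j - i) (drop i xs)) xs"
    using sublist_order.order_trans sublist_take sublist_drop by blast
  with ij show "\<exists>ys. ys \<noteq> [] \<and> sublist ys xs \<and> P ys"
    by (intro exI[of _ "take (j - i) (drop i xs)"]) auto
qed

lemma length_block: "i < j \<Longrightarrow> j \<le> length xs \<Longrightarrow> length (take (j - i) (drop i xs)) = j - i"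
  by simp

lemma sum_lessThan_diff:
  fixes f :: "nat \<Rightarrow> 'b::comm_monoid_add"
  shows "(\<Sum>t<j - i. f t) = (\<Sum>t=i..<j. f (t - i))"
  by (rule sum.reindex_bij_witness[of _ "\<lambda>t. t - i" "\<lambda>t. t + i"]) auto

lemma ex_sublist_weighted_zero_sum_iff:
  assumes "n \<ge> 2"
  shows "(\<exists>ys. ys \<noteq> [] \<and> sublist ys xs \<and> weighted_zero_sum (residue_ring n) A ys)
    \<longleftrightarrow> one_block n A xs"
proof -
  have "weighted_zero_sum (residue_ring n) A (take (j - i) (drop i xs)) \<longleftrightarrow>
      (\<exists>a. (\<forall>t\<in>{i..<j}. a t \<in> A) \<and> n dvd (\<Sum>t=i..<j. a t * xs ! t))" (is "?L \<longleftrightarrow> ?R")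
    if ij: "i < j" "j \<le> length xs" for i j
  proof
    assume ?L
    then obtain a where "\<forall>t<j - i. a t \<in> A"
        "n dvd (\<Sum>t<j - i. a t * take (j - i) (drop i xs) ! t)"
      unfolding weighted_zero_sum_iff[OF assms] length_block[OF ij] by blast
    \<comment> \<open>A list block numbers its weights from 0, hence the shift by
      \<open>i\<close>.\<close>
    then show ?R
      using ij by (intro exI[of _ "\<lambda>t. a (t - i)"]) (auto simp: sum_lessThan_diff)
  next
    assume ?R
    then obtain a where "\<forall>t\<in>{i..<j}. a t \<in> A" "n dvd (\<Sum>t=i..<j. a t * xs ! t)"
      by blast
    then show ?L
      unfolding weighted_zero_sum_iff[OF assms] length_block[OF ij]
      using ij by (intro exI[of _ "\<lambda>t. a (t + i)"]) (auto simp: sum_lessThan_diff)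
  qed
  then show ?thesis
    unfolding ex_sublist_iff one_block_def by blast
qed

lemma ex_sublist_weighted_zero_sum2_iff:
  assumes "n \<ge> 2"
  shows "(\<exists>ys. ys \<noteq> [] \<and> sublist ys xs \<and> weighted_zero_sum2 (residue_ring n) A B ys)
    \<longleftrightarrow> two_block n A B xs"
proof -
  have "weighted_zero_sum2 (residue_ring n) A B (take (j - i) (drop i xs)) \<longleftrightarrow>
      (\<exists>a b. (\<forall>t\<in>{i..<j}. a t \<in> A) \<and> (\<forall>t\<in>{i..<j}. b t \<in> B) \<and>
        n dvd (\<Sum>t=i..<j. a t * xs ! t) \<and> n dvd (\<Sum>t=i..<j. b t * a t))" (is "?L \<longleftrightarrow> ?R")
    if ij: "i < j" "j \<le> length xs" for i j
  proof
    assume ?L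
    then obtain a b where "\<forall>t<j - i. a t \<in> A" "\<forall>t<j - i. b t \<in> B"
        "n dvd (\<Sum>t<j - i. a t * take (j - i) (drop i xs) ! t)"
        "n dvd (\<Sum>t<j - i. b t * a t)"
      unfolding weighted_zero_sum2_iff[OF assms] length_block[OF ij] by blast
    then show ?R
      using ij
      by - (rule exI[of _ "\<lambda>t. a (t - i)"], rule exI[of _ "\<lambda>t. b (t - i)"],
          auto simp: sum_lessThan_diff)
  next
    assume ?R
    then obtain a b where "\<forall>t\<in>{i..<j}. a t \<in> A" "\<forall>t\<in>{i..<j}. b t \<in> B"
        "n dvd (\<Sum>t=i..<j. a t * xs ! t)" "n dvd (\<Sum>t=i..<j. b t * a t)"
      by blast
    then show ?L
      unfolding weighted_zero_sum2_iff[OF assms] length_block[OF ij] using ij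
      by - (rule exI[of _ "\<lambda>t. a (t + i)"], rule exI[of _ "\<lambda>t. b (t + i)"],
          auto simp: sum_lessThan_diff)
  qed
  then show ?thesis
    unfolding ex_sublist_iff two_block_def by blast
qed

lemma carrier_residue_ring: "carrier (residue_ring n) = {0..<n}"
  by (auto simp: residue_ring_def)

lemma Z_nonzero_eq: "Z_nonzero n = {1..<n}"
  by (auto simp: Z_nonzero_def carrier_residue_ring zero_residue_ring)

lemma U_eq:
  assumes "n \<ge> 2"
  shows "U n = {x. 0 < x \<and> x < n \<and> coprime x n}"
proof -
  interpret residues n "residue_ring n"
    by unfold_locales (use assms in auto)
  show ?thesis
    unfolding U_def by (rule res_units_eq)
qed

lemma mod_in_Z_nonzero:
  assumes "n \<ge> 2" and "\<not> n dvd x"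
  shows "x mod n \<in> Z_nonzero n"
  using assms pos_mod_bound[of n x] pos_mod_sign[of n x]
  unfolding Z_nonzero_eq dvd_eq_mod_eq_0 atLeastLessThan_iff by linarith

lemma C_one_eq:
  assumes "n \<ge> 2"
  shows "C_one A n = (LEAST k. k > 0 \<and>
    (\<forall>xs. set xs \<subseteq> {0..<n} \<and> length xs = k \<longrightarrow> one_block n A xs))"
  using assms by (simp add: C_one_def ex_sublist_weighted_zero_sum_iff carrier_residue_ring)

lemma C_two_eq:
  assumes "n \<ge> 2"
  shows "C_two A B n = (LEAST k. k > 0 \<and>
    (\<forall>xs. set xs \<subseteq> {0..<n} \<and> length xs = k \<longrightarrow> two_block n A B xs))"
  using assms by (simp add: C_two_def ex_sublist_weighted_zero_sum2_iff carrier_residue_ring)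

subsection \<open>The constant of one weight set\<close>

text \<open>Pigeonhole with constant weight \<open>c\<close>: two of the \<open>n + 1\<close> prefix
  sums agree modulo \<open>n\<close>, and their difference is a block sum. This makes the
  \<open>LEAST\<close> in \<open>C_one\<close> attained.\<close>

lemma one_block_if_length:
  assumes "n \<ge> 2" and "c \<in> A" and "length xs = nat n"
  shows "one_block n A xs"
proof -
  define S where "S l = (\<Sum>t<l. c * xs ! t) mod n" for l
  have "S ` {..nat n} \<subseteq> {0..<n}"
    using assms by (auto simp: S_def)
  then have "card (S ` {..nat n}) \<le> nat n"
    using card_mono[of "{0..<n}" "S ` {..nat n}"] by simp
  then have "\<not> inj_on S {..nat n}"
    by (auto dest: card_image)
  then obtain i j where ij: "i < j" "j \<le> nat n" "S i = S j"
    by (auto simp: inj_on_def) (metis linorder_neqE_nat)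
  have "n dvd (\<Sum>t<j. c * xs ! t) - (\<Sum>t<i. c * xs ! t)"
    using ij(3) unfolding S_def by (metis mod_eq_dvd_iff)
  moreover have "(\<Sum>t<j. c * xs ! t) - (\<Sum>t<i. c * xs ! t) = (\<Sum>t=i..<j. c * xs ! t)"
    using ij sum_diff_nat_ivl[of 0 i j "\<lambda>t. c * xs ! t"] by (simp add: lessThan_atLeast0)
  ultimately show ?thesis
    unfolding one_block_def using ij assms by (intro exI[of _ i] exI[of _ j] exI[of _ "\<lambda>_. c"]) simp
qed

lemma C_one_pos_and_block:
  assumes "n \<ge> 2" and "A \<noteq> {}"
  shows "C_one A n > 0 \<and>
    (\<forall>xs. set xs \<subseteq> {0..<n} \<and> length xs = C_one A n \<longrightarrow> one_block n A xs)"
  unfolding C_one_eq[OF assms(1)]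
  by (rule LeastI[of _ "nat n"]) (use assms one_block_if_length in auto)

lemma ex_not_one_block:
  assumes "n \<ge> 2" and "m < C_one A n"
  shows "\<exists>xs. set xs \<subseteq> {0..<n} \<and> length xs = m \<and> \<not> one_block n A xs"
proof (cases "m = 0")
  \<comment> \<open>Length 0 is excluded from the \<open>LEAST\<close> by \<open>k > 0\<close>, so
    minimality says nothing here; the empty sequence has no non-empty block.\<close>
  case True
  then show ?thesis
    by (auto simp: one_block_def)
next
  case False
  then show ?thesis
    using assms(2) not_less_Least unfolding C_one_eq[OF assms(1)] by blast
qed

lemma two_block_imp_one_block: "two_block n A B xs \<Longrightarrow> one_block n A xs"
  unfolding one_block_def two_block_def by blast

lemma two_block_take: "two_block n A B (take m xs) \<Longrightarrow> two_block n A B xs"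
  unfolding two_block_def
  by (elim exE conjE, intro exI conjI) (assumption | simp)+

text \<open>One bad sequence of length \<open>k - 1\<close> rules out all smaller lengths, since its
  prefixes are bad by \<open>two_block_take\<close>.\<close>

lemma C_two_eqI:
  assumes "n \<ge> 2" and "k > 0"
    and "\<And>xs. set xs \<subseteq> {0..<n} \<Longrightarrow> length xs = k \<Longrightarrow> two_block n A B xs"
    and zs: "set zs \<subseteq> {0..<n}" "length zs = k - 1" "\<not> two_block n A B zs"
  shows "C_two A B n = k"
  unfolding C_two_eq[OF assms(1)]
proof (rule Least_equality)
  fix m
  assume m: "0 < m \<and> (\<forall>xs. set xs \<subseteq> {0..<n} \<and> length xs = m \<longrightarrow> two_block n A B xs)"
  show "k \<le> m"
  proof (rule ccontr)
    assume "\<not> k \<le> m"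
    then have "length (take m zs) = m" "set (take m zs) \<subseteq> {0..<n}"
      using zs set_take_subset[of m zs] by auto
    with m zs(3) two_block_take show False
      by blast
  qed
qed (use assms in blast)

subsection \<open>Unit weights\<close>

lemma sum_double_interval:
  fixes f :: "nat \<Rightarrow> 'b::comm_monoid_add"
  assumes "i \<le> j"
  shows "(\<Sum>t=2*i..<2*j. f t) = (\<Sum>s=i..<j. f (2*s) + f (2*s+1))"
  using assms by (induction j rule: dec_induct) (simp_all add: add.assoc)

lemma two_block_double_length:
  assumes n: "n \<ge> 2" and k: "\<And>ys. set ys \<subseteq> {0..<n} \<Longrightarrow> length ys = k \<Longrightarrow> one_block n A ys"
    and xs: "length xs = 2 * k"
  shows "two_block n A (Z_nonzero n) xs"
proof -
  define ys where "ys = map (\<lambda>s. (xs!(2*s) + xs!(2*s+1)) mod n) [0..<k]"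
  have "set ys \<subseteq> {0..<n}" "length ys = k"
    using n by (auto simp: ys_def)
  then obtain i j a where ij: "i < j" "j \<le> k" and a: "\<forall>t\<in>{i..<j}. a t \<in> A"
    and dvd: "n dvd (\<Sum>s=i..<j. a s * ys ! s)"
    using k[of ys] unfolding one_block_def by metis
  \<comment> \<open>\<open>n - 1\<close> represents -1, so a pair with common weight
    \<open>w\<close> contributes \<open>w + (n - 1) * w = n * w\<close>.\<close>
  define b where "b t = (if even t then 1 else n - 1)" for t :: nat
  \<comment> \<open>Pair sums were reduced to stay in the carrier, so only a congruence
    holds.\<close>
  have "[(\<Sum>s=i..<j. a s * ys ! s) = (\<Sum>s=i..<j. a s * (xs!(2*s) + xs!(2*s+1)))] (mod n)"
    using ij by (intro cong_sum cong_mult) (auto simp: ys_def)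
  moreover have "(\<Sum>t=2*i..<2*j. a (t div 2) * xs ! t)
      = (\<Sum>s=i..<j. a s * (xs!(2*s) + xs!(2*s+1)))"
    using ij by (simp add: sum_double_interval distrib_left)
  ultimately have "n dvd (\<Sum>t=2*i..<2*j. a (t div 2) * xs ! t)"
    using dvd by (simp add: cong_dvd_iff)
  moreover have "n dvd (\<Sum>t=2*i..<2*j. b t * a (t div 2))"
    using ij by (auto simp: sum_double_interval b_def left_diff_distrib intro!: dvd_sum)
  moreover have "\<forall>t\<in>{2*i..<2*j}. b t \<in> Z_nonzero n"
    using n by (simp add: b_def Z_nonzero_eq)
  moreover have "t div 2 \<in> {i..<j}" if "t \<in> {2*i..<2*j}" for t
    using that by auto
  then have "\<forall>t\<in>{2*i..<2*j}. a (t div 2) \<in> A"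
    using a by blast
  ultimately show ?thesis
    unfolding two_block_def using ij xs
    by (intro exI[of _ "2*i"] exI[of _ "2*j"] exI[of _ "\<lambda>t. a (t div 2)"] exI[of _ b]) simp
qed

lemma not_two_block_interleave_zeros:
  assumes n: "n \<ge> 2" and A: "A \<subseteq> U n" and xs: "\<not> one_block n A xs"
  shows "\<not> two_block n A (Z_nonzero n)
    (map (\<lambda>t. if even t then 0 else xs ! (t div 2)) [0..<2 * length xs + 1])"
    (is "\<not> two_block _ _ _ ?zs")
proof
  assume "two_block n A (Z_nonzero n) ?zs"
  then obtain i j a b where ij: "i < j" "j \<le> 2 * length xs + 1"
    and a: "\<forall>t\<in>{i..<j}. a t \<in> A" and b: "\<forall>t\<in>{i..<j}. b t \<in> Z_nonzero n"
    and za: "n dvd (\<Sum>t=i..<j. a t * ?zs ! t)" and zb: "n dvd (\<Sum>t=i..<j. b t * a t)"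
    unfolding two_block_def by auto
  show False
  \<comment> \<open>Term \<open>s\<close> of \<open>xs\<close> sits at position
    \<open>2*s+1\<close>, which lies in \<open>{i..<j}\<close> iff
    \<open>i div 2 \<le> s < j div 2\<close>. The cases thus ask whether the block meets
    \<open>xs\<close>.\<close>
  proof (cases "i div 2 < j div 2")
    case True
    have "(\<Sum>t=i..<j. a t * ?zs ! t) = (\<Sum>t | t \<in> {i..<j} \<and> odd t. a t * xs ! (t div 2))"
      using ij by (intro sum.mono_neutral_cong_right) (auto simp del: upt_Suc)
    also have "\<dots> = (\<Sum>s=i div 2..<j div 2. a (2*s+1) * xs ! s)"
      by (rule sum.reindex_bij_witness[of _ "\<lambda>s. 2*s+1" "\<lambda>t. t div 2"]) (auto elim!: oddE)
    finally have "n dvd (\<Sum>s=i div 2..<j div 2. a (2*s+1) * xs ! s)"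
      using za by simp
    moreover have "2*s+1 \<in> {i..<j}" if "s \<in> {i div 2..<j div 2}" for s
      using that by auto
    then have "\<forall>s\<in>{i div 2..<j div 2}. a (2*s+1) \<in> A"
      using a by blast
    moreover have "j div 2 \<le> length xs"
      using ij by simp
    ultimately have "one_block n A xs"
      unfolding one_block_def using True
      by (intro exI[of _ "i div 2"] exI[of _ "j div 2"] exI[of _ "\<lambda>s. a (2*s+1)"]) simp
    with xs show False ..
  next
    case False
    \<comment> \<open>Two adjacent positions include an odd one, so only a single inserted zero
      remains; its unit weight would force its coefficient \<open>b i\<close> to vanish.\<close>
    with ij have "j = i + 1"
      by presburger
    then have "{i..<j} = {i}"
      by auto
    then have "n dvd b i * a i" "a i \<in> U n" "b i \<in> {1..<n}"
      using a b zb A by (auto simp: Z_nonzero_eq)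
    then have "n dvd b i"
      using n by (simp add: U_eq coprime_commute coprime_dvd_mult_left_iff)
    with \<open>b i \<in> {1..<n}\<close> show False
      by (auto dest: zdvd_imp_le)
  qed
qed

subsection \<open>Weights including a non-unit\<close>

text \<open>The witness is \<open>n\<close> divided by \<open>gcd x n\<close>; it is below
  \<open>n\<close> because the gcd exceeds 1.\<close>

lemma annihilator_if_not_coprime:
  fixes x n :: int
  assumes "n \<ge> 2" and "\<not> coprime x n"
  shows "\<exists>y\<in>Z_nonzero n. n dvd y * x"
proof -
  define g where "g = gcd x n"
  have "g > 0" "g \<noteq> 1" "g dvd n" "g dvd x"
    using assms by (auto simp: g_def coprime_iff_gcd_eq_1)
  then obtain y z where yz: "n = g * y" "x = g * z"
    by (auto elim!: dvdE)
  have "y > 0"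
    using yz assms(1) \<open>g > 0\<close> zero_less_mult_pos[of g y] by simp
  moreover have "y < n"
    using yz \<open>y > 0\<close> \<open>g > 0\<close> \<open>g \<noteq> 1\<close> by simp
  ultimately have "y \<in> Z_nonzero n"
    by (simp add: Z_nonzero_eq)
  moreover have "n dvd y * x"
    by (simp add: yz)
  ultimately show ?thesis ..
qed

text \<open>Changing the coefficient at \<open>j\<close> from 1 to 2 changes the sum by
  \<open>a j\<close>, so both sums cannot vanish. The bound \<open>n \<ge> 3\<close> keeps 2
  nonzero.\<close>

lemma ex_coeffs_sum_nonzero:
  fixes a :: "'i \<Rightarrow> int"
  assumes n: "n \<ge> 3" and I: "finite I" "j \<in> I" and a: "\<not> n dvd a j"
  shows "\<exists>b. (\<forall>i\<in>I. b i \<in> Z_nonzero n) \<and> \<not> n dvd (\<Sum>i\<in>I. b i * a i)"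
proof -
  let ?b = "\<lambda>c i. if i = j then c else (1::int)"
  have eq: "(\<Sum>i\<in>I. ?b c i * a i) = c * a j + (\<Sum>i\<in>I - {j}. a i)" for c
    using I by (simp add: sum.remove[of I j])
  have "(\<Sum>i\<in>I. ?b 2 i * a i) - (\<Sum>i\<in>I. ?b 1 i * a i) = a j"
    unfolding eq by simp
  with a have "\<not> n dvd (\<Sum>i\<in>I. ?b 2 i * a i) \<or> \<not> n dvd (\<Sum>i\<in>I. ?b 1 i * a i)"
    by (metis dvd_diff)
  moreover have "\<forall>i\<in>I. ?b 2 i \<in> Z_nonzero n" "\<forall>i\<in>I. ?b 1 i \<in> Z_nonzero n"
    using n by (auto simp: Z_nonzero_eq)
  ultimately show ?thesis
    by (elim disjE) (rule exI[of _ "?b 2"], blast, rule exI[of _ "?b 1"], blast)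
qed

text \<open>The hypothesis \<open>units\<close> excludes a lone unit, which no nonzero coefficient
  annihilates.\<close>

lemma ex_coeffs_sum_zero:
  fixes a :: "'i \<Rightarrow> int"
  assumes n: "n \<ge> 3" and I: "finite I" and a: "\<And>i. i \<in> I \<Longrightarrow> a i \<in> Z_nonzero n"
    and units: "\<And>i. i \<in> I \<Longrightarrow> coprime (a i) n \<Longrightarrow> I \<noteq> {i}"
  shows "\<exists>b. (\<forall>i\<in>I. b i \<in> Z_nonzero n) \<and> n dvd (\<Sum>i\<in>I. b i * a i)"
proof (cases "\<exists>u\<in>I. coprime (a u) n")
  case False
  then have "\<forall>i\<in>I. \<exists>y\<in>Z_nonzero n. n dvd y * a i"
    using annihilator_if_not_coprime[of n] n by auto
  then obtain b where "\<forall>i\<in>I. b i \<in> Z_nonzero n \<and> n dvd b i * a i"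
    by metis
  then show ?thesis
    by (intro exI[of _ b]) (auto intro: dvd_sum)
next
  case True
  then obtain u where u: "u \<in> I" "coprime (a u) n"
    by blast
  with units obtain j where j: "j \<in> I - {u}"
    by blast
  then have "\<not> n dvd a j"
    using a[of j] by (auto simp: Z_nonzero_eq dest: zdvd_imp_le)
  then obtain b where b: "\<forall>i\<in>I - {u}. b i \<in> Z_nonzero n"
      "\<not> n dvd (\<Sum>i\<in>I - {u}. b i * a i)"
    using ex_coeffs_sum_nonzero[of n "I - {u}" j a] n I j by auto
  define s where "s = (\<Sum>i\<in>I - {u}. b i * a i)"
  obtain v where v: "[a u * v = 1] (mod n)"
    using cong_solve_coprime_int[OF u(2)] by blast
  \<comment> \<open>As \<open>v\<close> inverts \<open>a u\<close>, this solves
    \<open>?c * a u + s = 0\<close> modulo \<open>n\<close>.\<close>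
  let ?c = "(- v * s) mod n"
  have "[?c * a u = - (a u * v) * s] (mod n)"
    by (simp add: cong_def mod_simps algebra_simps)
  also have "[- (a u * v) * s = - 1 * s] (mod n)"
    using v by (intro cong_mult cong_minus_minus_iff[THEN iffD2]) auto
  finally have c: "n dvd ?c * a u + s"
    by (simp add: cong_iff_dvd_diff)
  \<comment> \<open>A vanishing \<open>?c\<close> would make \<open>s\<close> vanish, contrary to
    the choice of \<open>b\<close>.\<close>
  have "\<not> n dvd ?c"
  proof
    assume "n dvd ?c"
    then have "n dvd ?c * a u + s - ?c * a u"
      using c by (intro dvd_diff dvd_mult2)
    with b(2) show False
      by (simp add: s_def)
  qed
  then have "?c mod n \<in> Z_nonzero n"
    using n by (intro mod_in_Z_nonzero) auto
  moreover have "(\<Sum>i\<in>I. (b(u := ?c)) i * a i) = ?c * a u + s"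
    using I u(1) by (simp add: sum.remove[of I u] s_def)
  ultimately show ?thesis
    using b c by (intro exI[of _ "b(u := ?c)"]) auto
qed

lemma one_block_imp_two_block:
  assumes n: "n \<ge> 2" and A: "A \<subseteq> Z_nonzero n" "\<not> A \<subseteq> U n" and xs: "one_block n A xs"
  shows "two_block n A (Z_nonzero n) xs"
proof -
  obtain d where d: "d \<in> A" "\<not> coprime d n"
    using A n by (auto simp: U_eq Z_nonzero_eq)
  \<comment> \<open>1 is coprime to \<open>n\<close>, so \<open>d\<close> is at least 2 and below
    \<open>n\<close>.\<close>
  then have "1 \<le> d" "d < n" "d \<noteq> 1"
    using A(1) by (auto simp: Z_nonzero_eq)
  then have n3: "n \<ge> 3"
    by linarith
  obtain i j a where ij: "i < j" "j \<le> length xs" and a: "\<forall>t\<in>{i..<j}. a t \<in> A"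
    and za: "n dvd (\<Sum>t=i..<j. a t * xs ! t)"
    using xs unfolding one_block_def by blast
  \<comment> \<open>The weights are changed, if necessary, to avoid a lone unit.\<close>
  have "\<exists>a. (\<forall>t\<in>{i..<j}. a t \<in> A) \<and> n dvd (\<Sum>t=i..<j. a t * xs ! t) \<and>
      (\<forall>u\<in>{i..<j}. coprime (a u) n \<longrightarrow> {i..<j} \<noteq> {u})"
  proof (cases "\<exists>u\<in>{i..<j}. coprime (a u) n \<and> {i..<j} = {u}")
    case True
    then obtain u where u: "coprime (a u) n" "{i..<j} = {u}"
      by blast
    \<comment> \<open>Cancelling the unit weight shows the only term to be zero, so weight
      \<open>d\<close> serves as well.\<close>
    then have "n dvd xs ! u"
      using za by (simp add: coprime_commute coprime_dvd_mult_right_iff)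
    then show ?thesis
      using d u by (intro exI[of _ "\<lambda>_. d"]) simp
  qed (use a za in blast)
  then obtain a' where a': "\<forall>t\<in>{i..<j}. a' t \<in> A" "n dvd (\<Sum>t=i..<j. a' t * xs ! t)"
      "\<forall>u\<in>{i..<j}. coprime (a' u) n \<longrightarrow> {i..<j} \<noteq> {u}"
    by blast
  then obtain b where "\<forall>t\<in>{i..<j}. b t \<in> Z_nonzero n" "n dvd (\<Sum>t=i..<j. b t * a' t)"
    using ex_coeffs_sum_zero[of n "{i..<j}" a'] n3 A by blast
  with ij a' show ?thesis
    unfolding two_block_def by blast
qed

theorem theorem16:
  fixes n :: int and A :: "int set"
  assumes "n \<ge> 2" and "A \<noteq> {}"
  shows "(A \<subseteq> U n \<longrightarrow> C_two A (Z_nonzero n) n = 2 * C_one A n) \<and>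
    (A \<subseteq> Z_nonzero n \<and> \<not> A \<subseteq> U n \<longrightarrow> C_two A (Z_nonzero n) n = C_one A n)"
proof -
  define k where "k = C_one A n"
  have k: "k > 0" "\<And>xs. set xs \<subseteq> {0..<n} \<Longrightarrow> length xs = k \<Longrightarrow> one_block n A xs"
    using C_one_pos_and_block[OF assms] by (auto simp: k_def)
  obtain xs where xs: "set xs \<subseteq> {0..<n}" "length xs = k - 1" "\<not> one_block n A xs"
    using ex_not_one_block[of n "k - 1" A] assms k(1) by (auto simp: k_def)
  have "C_two A (Z_nonzero n) n = 2 * k" if A: "A \<subseteq> U n"
  proof (rule C_two_eqI)
    \<comment> \<open>The length is \<open>2 * (k - 1) + 1 = 2 * k - 1\<close>, as
      \<open>C_two_eqI\<close> demands.\<close>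
    let ?zs = "map (\<lambda>t. if even t then 0 else xs ! (t div 2)) [0..<2 * length xs + 1]"
    have "xs ! (t div 2) \<in> set xs" if "odd t" "t < 2 * length xs + 1" for t
      using that by (intro nth_mem) (auto elim!: oddE)
    then show "set ?zs \<subseteq> {0..<n}"
      using xs(1) assms(1) by (auto simp del: upt_Suc)
    show "\<not> two_block n A (Z_nonzero n) ?zs"
      using not_two_block_interleave_zeros[OF assms(1) A xs(3)] .
  qed (use assms k xs two_block_double_length[OF assms(1) k(2)] in auto)
  \<comment> \<open>Here both kinds of block exist for the same sequences, so \<open>xs\<close>
    itself is the bad sequence.\<close>
  moreover have "C_two A (Z_nonzero n) n = k" if "A \<subseteq> Z_nonzero n" "\<not> A \<subseteq> U n"
    using assms k xs that one_block_imp_two_block two_block_imp_one_block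
    by (intro C_two_eqI[of n k A "Z_nonzero n" xs]) auto
  ultimately show ?thesis
    by (simp add: k_def)
qed

end
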